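(* Let $0<\epsilon\le 1$, let $A\in\mathbb{R}^{n\times d}$ and let $k\ge 1$ be an integer. Let $B\in\mathbb{R}^{n\times(d+1)}$ be the matrix (of rank $O(k/\epsilon^2)$) output by the procedure DimensionalityReduction run on $A$ with parameters $k$, $p=1$ and accuracy parameter $\epsilon/2$. Let $C\subseteq\mathbb{R}^d$ be an arbitrary non-empty set that is contained in some $k$-dimensional linear subspace. Let $A'\in\mathbb{R}^{n\times d}$ be a matrix whose $i$-th row is a closest point of the closure of $C$ to the $i$-th row of $A$, and let $B'\in\mathbb{R}^{n\times d}$ be a matrix whose $i$-th row is a closest point of the closure of $C$ to the $i$-th row of $BI$. Then $$\big|\,\|A-A'\|_{1,2}-\|B-B'I^T\|_{1,2}\,\big|\le \epsilon\,\|A-A'\|_{1,2}.$$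
   Context: For a matrix $M$ with rows $M_{i*}$, $\|M\|_{p,2}=(\sum_i\|M_{i*}\|_2^p)^{1/p}$. $I\in\mathbb{R}^{(d+1)\times d}$ is the matrix with diagonal entries $1$ and all other entries $0$ (so $BI$ consists of the first $d$ columns of $B$, and $B'I^T$ appends a zero column to $B'$). Subspaces are linear subspaces of $\mathbb{R}^d$. For a subspace $S$, $\mathrm{cost}_p(A,S)=\sum_{i=1}^n \mathrm{dist}(A_{i*},S)^p$ (Euclidean distance). Procedure DimensionalityReduction$(A,k,\epsilon,p)$: let $\mathrm{opt}$ be the minimum of $\mathrm{cost}_p(A,S)$ over $k$-dimensional subspaces $S$; compute a $k$-dimensional subspace $S$ with $\mathrm{cost}_p(A,S)\le(1+\epsilon)\mathrm{opt}$; set $k^*=k$; while there exists a subspace $S'\supseteq S$ of dimension $k^*+k$ with $\mathrm{cost}_p(A,S')\le \mathrm{cost}_p(A,S)-\epsilon^{\max\{2/p,1\}}\mathrm{opt}/80$, set $k^*=k^*+k$ and $S=S'$; finally let $A'$ be the orthogonal projection of the rows of $A$ onto $S$ and output $B\in\mathbb{R}^{n\times(d+1)}$ whose first $d$ columns equal $A'$ and whose last column has $i$-th entry $\|A_{i*}-A'_{i*}\|_2$.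
   Formalization: In the loop, S' strictly contains S and has dimension min(k*+k, d) instead of k*+k. Stopping whenever k*+k>d makes the claim false: A with rows e1,e2,e3, k=2, S=span{e1,e2}, C=span{e2,e3} gives norms 1 and 2, for ε<1. *)

theory Defs
  imports "HOL-Analysis.Analysis"
begin

text \<open>A matrix in \<open>\<real>\<^sup>n\<^sup>\<times>\<^sup>d\<close> has type \<^typ>\<open>real ^ 'd ^ 'n\<close>; \<open>M $ i\<close> is its \<open>i\<close>-th row.  The \<open>d + 1\<close>
  columns of the reduced matrix are indexed by \<^typ>\<open>'d option\<close>: \<open>Some j\<close> stands for column \<open>j\<close>
  and \<open>None\<close> for the additional last column.\<close>

definition norm_p2 :: "real \<Rightarrow> real ^ 'm ^ 'n \<Rightarrow> real" where
  "norm_p2 p M = (\<Sum>i\<in>UNIV. norm (M $ i) powr p) powr (1 / p)"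

definition drop_last :: "real ^ 'd ^ 'd option" where
  "drop_last = (\<chi> i j. if i = Some j then 1 else 0)"

definition cost :: "real \<Rightarrow> real ^ 'd ^ 'n \<Rightarrow> (real ^ 'd) set \<Rightarrow> real" where
  "cost p A S = (\<Sum>i\<in>UNIV. infdist (A $ i) S powr p)"

definition opt :: "real \<Rightarrow> real ^ 'd ^ 'n \<Rightarrow> nat \<Rightarrow> real" where
  "opt p A k = Inf {cost p A S | S. subspace S \<and> dim S = k}"

definition is_closest_point :: "'a::metric_space set \<Rightarrow> 'a \<Rightarrow> 'a \<Rightarrow> bool" where
  "is_closest_point T x y \<longleftrightarrow> y \<in> T \<and> (\<forall>z\<in>T. dist x y \<le> dist x z)"

definition is_orthogonal_projection :: "'a::real_inner set \<Rightarrow> 'a \<Rightarrow> 'a \<Rightarrow> bool" where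
  "is_orthogonal_projection S x y \<longleftrightarrow> y \<in> S \<and> (\<forall>z\<in>S. orthogonal (x - y) z)"

text \<open>One iteration of the loop; \<open>dim S\<close> plays the role of the counter \<open>k\<^sup>*\<close>.  The new dimension
  is capped at the ambient dimension: when \<open>dim S + k\<close> exceeds it, the loop may still pass to the
  whole space.  Stopping there instead would make the approximation guarantee false: for
  \<open>A\<close> with rows \<open>e\<^sub>1, e\<^sub>2, e\<^sub>3\<close> in \<open>\<real>\<^sup>3\<close>, \<open>k = 2\<close>, \<open>S = span {e\<^sub>1, e\<^sub>2}\<close> and
  \<open>C = span {e\<^sub>2, e\<^sub>3}\<close> the two norms would be \<open>1\<close> and \<open>2\<close>.  The inclusion is strict so that
  the loop ends at the whole space also if \<open>opt p A k = 0\<close>.\<close>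

definition dr_step ::
  "real ^ 'd ^ 'n \<Rightarrow> nat \<Rightarrow> real \<Rightarrow> real \<Rightarrow> (real ^ 'd) set \<Rightarrow> (real ^ 'd) set \<Rightarrow> bool" where
  "dr_step A k \<epsilon> p S S' \<longleftrightarrow>
     subspace S' \<and> S \<subset> S' \<and> dim S' = min (dim S + k) CARD('d) \<and>
     cost p A S' \<le> cost p A S - \<epsilon> powr (max (2 / p) 1) * opt p A k / 80"

lemma dr_step_uncapped:
  fixes A :: "real ^ 'd ^ 'n"
  assumes "k \<ge> 1" "dim S + k \<le> CARD('d)"
  shows "dr_step A k \<epsilon> p S S' \<longleftrightarrow>
     subspace S' \<and> S \<subseteq> S' \<and> dim S' = dim S + k \<and>
     cost p A S' \<le> cost p A S - \<epsilon> powr (max (2 / p) 1) * opt p A k / 80"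
  using assms by (auto simp: dr_step_def)

text \<open>The procedure makes choices, so it is rendered as a relation between input and output.\<close>

definition dimensionality_reduction ::
  "real ^ 'd ^ 'n \<Rightarrow> nat \<Rightarrow> real \<Rightarrow> real \<Rightarrow> real ^ 'd option ^ 'n \<Rightarrow> bool" where
  "dimensionality_reduction A k \<epsilon> p B \<longleftrightarrow>
     (\<exists>S\<^sub>0 S (A' :: real ^ 'd ^ 'n).
        subspace S\<^sub>0 \<and> dim S\<^sub>0 = k \<and> cost p A S\<^sub>0 \<le> (1 + \<epsilon>) * opt p A k \<and>
        (dr_step A k \<epsilon> p)\<^sup>*\<^sup>* S\<^sub>0 S \<and> (\<nexists>S'. dr_step A k \<epsilon> p S S') \<and>
        (\<forall>i. is_orthogonal_projection S (A $ i) (A' $ i)) \<and>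
        B = (\<chi> i j. case j of Some l \<Rightarrow> A' $ i $ l | None \<Rightarrow> norm (A $ i - A' $ i)))"

end

theory Submission
  imports Defs
begin

text \<open>Let \<open>S\<close> be the final subspace, \<open>V \<supseteq> C\<close> of dimension \<open>k\<close>, and \<open>S'\<close> a subspace containing \<open>S\<close>
  and \<open>V\<close> whose dimension is that of a possible next iterate, so that \<open>S'\<close> lowers the cost by at
  most \<open>\<epsilon>\<^sup>2 opt / 320\<close>.  For a row \<open>a\<close> with projections \<open>y\<close> to \<open>S\<close> and \<open>z\<close> to \<open>S'\<close>, at distances \<open>r\<close>
  and \<open>q\<close>, every \<open>c \<in> V\<close> has \<open>\<bar>a - c\<bar> = \<bar>(z - c, q)\<bar>\<close>, whereas the reduced matrix sees
  \<open>\<bar>(y - c, r)\<bar>\<close>.  Since \<open>\<bar>z - y\<bar>\<^sup>2 = r\<^sup>2 - q\<^sup>2\<close>, the two values differ by at most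
  \<open>sqrt (2 r (r - q))\<close>.  This bound is uniform in \<open>c\<close>, hence passes to the minimum over \<open>C\<close>; summing
  over the rows with Cauchy--Schwarz gives the error bound.

  For the rank, every iteration lowers the cost by \<open>\<epsilon>\<^sup>2 opt / 320\<close>, starting from at most
  \<open>(3/2) opt\<close>, so there are at most \<open>480 / \<epsilon>\<^sup>2\<close> iterations if \<open>opt > 0\<close>.  If \<open>opt = 0\<close> the loop runs
  up to the whole space, but then the rows of \<open>A\<close> already lie in the initial subspace.\<close>

section \<open>Orthogonal projections and the distortion of distances\<close>

lemma orthogonal_projection_exists:
  fixes S :: "'a::euclidean_space set"
  assumes "subspace S"
  shows "\<exists>y. is_orthogonal_projection S x y"
proof -
  obtain y z where "y \<in> span S" "\<And>w. w \<in> span S \<Longrightarrow> orthogonal z w" "x = y + z"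
    using orthogonal_subspace_decomp_exists[of S x] by metis
  with assms show ?thesis
    by (intro exI[of _ y]) (auto simp: is_orthogonal_projection_def span_eq_iff[THEN iffD2])
qed

lemma orthogonal_projection_pythagoras:
  assumes "subspace S" "is_orthogonal_projection S x y" "c \<in> S"
  shows "(norm (x - c))\<^sup>2 = (norm (x - y))\<^sup>2 + (norm (y - c))\<^sup>2"
proof -
  have "orthogonal (x - y) (y - c)"
    using assms by (auto simp: is_orthogonal_projection_def intro: subspace_diff)
  from norm_add_Pythagorean[OF this] show ?thesis by simp
qed

lemma infdist_eq_norm_orthogonal_projection:
  assumes "subspace S" "is_orthogonal_projection S x y"
  shows "infdist x S = norm (x - y)"
proof (rule antisym)
  have y: "y \<in> S" using assms(2) by (simp add: is_orthogonal_projection_def)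
  then show "infdist x S \<le> norm (x - y)"
    using infdist_le[OF y, of x] by (simp add: dist_norm)
  have "norm (x - y) \<le> dist x z" if "z \<in> S" for z
  proof -
    have "(norm (x - y))\<^sup>2 \<le> (norm (x - z))\<^sup>2"
      using orthogonal_projection_pythagoras[OF assms that] by simp
    then show ?thesis by (simp add: dist_norm)
  qed
  then show "norm (x - y) \<le> infdist x S"
    using y by (auto simp: infdist_def intro!: cINF_greatest)
qed

text \<open>Pythagoras read as a norm in a product space: the extra coordinate stores the distance
  to the subspace, as the last column of \<open>B\<close> does.\<close>

lemma norm_Pair_orthogonal_projection:
  assumes "subspace S" "is_orthogonal_projection S x y" "c \<in> S"
  shows "norm (x - c) = norm (y - c, norm (x - y))"
  using orthogonal_projection_pythagoras[OF assms]
  by (simp add: norm_Pair real_sqrt_unique add.commute)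

text \<open>Both quantities are norms of pairs, and \<open>c\<close> cancels in the difference
  \<open>(z - y, ?q - ?r)\<close> of these pairs; the reverse triangle inequality therefore gives a
  bound free of \<open>c\<close>.\<close>

lemma distance_distortion:
  assumes S: "subspace S" "is_orthogonal_projection S x y"
    and T: "subspace T" "is_orthogonal_projection T x z"
    and "S \<subseteq> T" "c \<in> T"
  shows "\<bar>norm (x - c) - norm (y - c, norm (x - y))\<bar>
    \<le> sqrt (2 * norm (x - y) * (norm (x - y) - norm (x - z)))"
proof -
  let ?r = "norm (x - y)" and ?q = "norm (x - z)"
  have "y \<in> T" using S(2) \<open>S \<subseteq> T\<close> by (auto simp: is_orthogonal_projection_def)
  from orthogonal_projection_pythagoras[OF T this]
  have w: "(norm (z - y))\<^sup>2 = ?r\<^sup>2 - ?q\<^sup>2" by simp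
  have "\<bar>norm (x - c) - norm (y - c, ?r)\<bar> = \<bar>norm (z - c, ?q) - norm (y - c, ?r)\<bar>"
    using norm_Pair_orthogonal_projection[OF T \<open>c \<in> T\<close>] by simp
  also have "\<dots> \<le> norm ((z - c, ?q) - (y - c, ?r))" by (rule norm_triangle_ineq3)
  also have "\<dots> = sqrt ((norm (z - y))\<^sup>2 + (?q - ?r)\<^sup>2)" by (simp add: norm_Pair)
  also have "(norm (z - y))\<^sup>2 + (?q - ?r)\<^sup>2 = 2 * ?r * (?r - ?q)"
    unfolding w by (simp add: power2_eq_square algebra_simps)
  finally show ?thesis .
qed

section \<open>Auxiliary inequalities and subspaces of intermediate dimension\<close>

text \<open>Each minimizer is tested in the other function:
  \<open>f a \<le> f b \<le> g b + e\<close> and \<open>g b \<le> g a \<le> f a + e\<close>. Thus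
  \<open>A'\<close> and \<open>B'\<close> may pick different points of \<open>C\<close>.\<close>

lemma abs_diff_le_of_minimizers:
  fixes f g :: "'a \<Rightarrow> real"
  assumes "\<And>c. c \<in> C \<Longrightarrow> \<bar>f c - g c\<bar> \<le> e"
    and "a \<in> C" "\<And>c. c \<in> C \<Longrightarrow> f a \<le> f c"
    and "b \<in> C" "\<And>c. c \<in> C \<Longrightarrow> g b \<le> g c"
  shows "\<bar>f a - g b\<bar> \<le> e"
  using assms(1)[OF assms(2)] assms(1)[OF assms(4)] assms(3)[OF assms(4)] assms(5)[OF assms(2)]
  by linarith

text \<open>Cauchy-Schwarz for the square roots of \<open>f\<close> and \<open>g\<close>.\<close>

lemma sum_sqrt_mult_le:
  fixes f g :: "'a \<Rightarrow> real"
  assumes "\<And>i. i \<in> I \<Longrightarrow> 0 \<le> f i" "\<And>i. i \<in> I \<Longrightarrow> 0 \<le> g i"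
  shows "(\<Sum>i\<in>I. sqrt (f i * g i)) \<le> sqrt (sum f I * sum g I)"
proof -
  have "(\<Sum>i\<in>I. sqrt (f i * g i)) = (\<Sum>i\<in>I. \<bar>sqrt (f i)\<bar> * \<bar>sqrt (g i)\<bar>)"
    using assms by (intro sum.cong) (auto simp: real_sqrt_mult)
  also have "\<dots> \<le> L2_set (\<lambda>i. sqrt (f i)) I * L2_set (\<lambda>i. sqrt (g i)) I"
    by (rule L2_set_mult_ineq)
  also have "\<dots> = sqrt (sum f I * sum g I)"
    using assms by (simp add: L2_set_def real_sqrt_mult cong: sum.cong)
  finally show ?thesis .
qed

text \<open>A basis of \<open>T\<close> is extended to one of the whole space; \<open>m\<close> of
  its vectors, including the basis of \<open>T\<close>, span the result.\<close>

lemma subspace_of_dim_between: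
  fixes T :: "'a::euclidean_space set"
  assumes "subspace T" "dim T \<le> m" "m \<le> DIM('a)"
  obtains S where "subspace S" "T \<subseteq> S" "dim S = m"
proof -
  obtain X where X: "X \<subseteq> T" "independent X" "T \<subseteq> span X" "card X = dim T"
    using basis_exists[of T] by metis
  obtain Y where Y: "X \<subseteq> Y" "independent Y" "UNIV \<subseteq> span Y"
    using maximal_independent_subset_extend[OF subset_UNIV X(2)] by metis
  have "card Y = DIM('a)"
    using dim_eq_card[of Y UNIV, OF _ Y(2)] Y(3) by (metis dim_UNIV span_UNIV top.extremum_uniqueI)
  then obtain K where K: "X \<subseteq> K" "K \<subseteq> Y" "card K = m"
    using exists_subset_between[of X m Y] assms X Y(1) independent_imp_finite[OF Y(2)] by auto
  show thesis
  proof
    show "T \<subseteq> span K" using X(3) span_mono[OF K(1)] by blast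
    show "dim (span K) = m"
      using independent_mono[OF Y(2) K(2)] K(3) by (simp add: dim_eq_card_independent)
  qed simp
qed

section \<open>Costs, the optimum and the loop\<close>

lemma cost_1: "cost 1 A S = (\<Sum>i\<in>UNIV. infdist (A $ i) S)"
  by (simp add: cost_def infdist_nonneg)

lemma norm_p2_1: "norm_p2 1 M = (\<Sum>i\<in>UNIV. norm (M $ i))"
  by (simp add: norm_p2_def sum_nonneg)

lemma cost_nonneg: "0 \<le> cost p A S"
  by (simp add: cost_def sum_nonneg)

lemma cost_1_antimono: "S \<noteq> {} \<Longrightarrow> S \<subseteq> T \<Longrightarrow> cost 1 A T \<le> cost 1 A S"
  by (auto simp: cost_1 intro!: sum_mono infdist_mono)

lemma opt_le_cost: "subspace S \<Longrightarrow> dim S = k \<Longrightarrow> opt p A k \<le> cost p A S"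
  unfolding opt_def by (rule cInf_lower) (auto intro!: bdd_belowI[of _ 0] cost_nonneg)

lemma opt_nonneg:
  fixes A :: "real ^ 'd ^ 'n" and S :: "(real ^ 'd) set"
  assumes "subspace S" "dim S = k"
  shows "0 \<le> opt p A k"
  unfolding opt_def by (rule cInf_greatest) (use assms in \<open>auto simp: cost_nonneg\<close>)

text \<open>Here \<open>m\<close> counts iterations. The dimension is only bounded above, since a
  step capped at the ambient dimension may gain less than \<open>k\<close>.\<close>

lemma dr_steps_invariant:
  assumes "(dr_step A k \<epsilon> p)\<^sup>*\<^sup>* S\<^sub>0 S" "subspace S\<^sub>0"
  shows "\<exists>m::nat. subspace S \<and> S\<^sub>0 \<subseteq> S \<and> dim S \<le> dim S\<^sub>0 + m * k \<and>
    cost p A S + m * (\<epsilon> powr max (2 / p) 1 * opt p A k / 80) \<le> cost p A S\<^sub>0"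
  using assms
proof (induction rule: rtranclp_induct)
  case base
  then show ?case by (intro exI[of _ 0]) simp
next
  case (step T U)
  let ?\<delta> = "\<epsilon> powr max (2 / p) 1 * opt p A k / 80"
  obtain m :: nat where m: "S\<^sub>0 \<subseteq> T" "dim T \<le> dim S\<^sub>0 + m * k"
      "cost p A T + m * ?\<delta> \<le> cost p A S\<^sub>0"
    using step by blast
  have U: "subspace U" "T \<subseteq> U" "dim U \<le> dim T + k" "cost p A U \<le> cost p A T - ?\<delta>"
    using step.hyps(2) by (auto simp: dr_step_def)
  have "cost p A U + Suc m * ?\<delta> \<le> cost p A S\<^sub>0"
    using m(3) U(4) unfolding of_nat_Suc distrib_right by linarith
  with m U show ?case by (intro exI[of _ "Suc m"]) auto
qed

section \<open>Rows with an appended coordinate\<close>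

text \<open>A row of the reduced matrix as a function of the pair \<open>(x, t)\<close>, which links
  it to norms in the product space.\<close>

definition snoc_vec :: "real ^ 'd \<Rightarrow> real \<Rightarrow> real ^ 'd option" where
  "snoc_vec x t = (\<chi> j. case j of Some l \<Rightarrow> x $ l | None \<Rightarrow> t)"

lemma norm_snoc_vec: "norm (snoc_vec x t) = norm (x, t)"
proof -
  have "(\<Sum>j\<in>UNIV. (snoc_vec x t $ j)\<^sup>2) = t\<^sup>2 + (\<Sum>j\<in>UNIV. (x $ j)\<^sup>2)"
    by (simp add: UNIV_option_conv snoc_vec_def sum.reindex)
  then show ?thesis
    by (simp add: norm_vec_def L2_set_def norm_Pair sum_nonneg add.commute)
qed

lemma snoc_vec_diff: "snoc_vec x s - snoc_vec y t = snoc_vec (x - y) (s - t)"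
  by (auto simp: snoc_vec_def vec_eq_iff split: option.split)

lemma linear_snoc_vec_0: "linear (\<lambda>x. snoc_vec x 0)"
  by (rule linearI) (auto simp: snoc_vec_def vec_eq_iff split: option.split)

lemma snoc_vec_eq: "snoc_vec x t = snoc_vec x 0 + t *\<^sub>R axis None 1"
  by (auto simp: snoc_vec_def vec_eq_iff axis_def split: option.split)

lemma matrix_mult_drop_last: "(\<chi> i. snoc_vec (X i) (t i)) ** drop_last = (\<chi> i. X i)"
  by (simp add: vec_eq_iff matrix_matrix_mult_def drop_last_def snoc_vec_def UNIV_option_conv
      sum.reindex if_distrib sum.delta cong: if_cong)

lemma matrix_mult_transpose_drop_last:
  fixes M :: "real ^ 'd ^ 'n"
  shows "(M ** transpose drop_last) $ i = snoc_vec (M $ i) 0"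
proof -
  have "(M ** transpose drop_last) $ i $ j = snoc_vec (M $ i) 0 $ j" for j
    by (cases j) (simp_all add: matrix_matrix_mult_def drop_last_def snoc_vec_def transpose_def
        if_distrib sum.delta cong: if_cong)
  then show ?thesis by (simp add: vec_eq_iff)
qed

text \<open>Serves the rank bound when the optimum is 0 and the last column of \<open>B\<close>
  vanishes.\<close>

lemma dim_snoc_vec_le:
  fixes S :: "(real ^ 'd) set"
  assumes "R \<subseteq> (\<lambda>x. snoc_vec x 0) ` S"
  shows "dim R \<le> dim S"
  using dim_subset[OF assms] dim_image_le[OF linear_snoc_vec_0, of S] by linarith

text \<open>The appended coordinate adds the single direction \<open>axis None 1\<close>.\<close>

lemma dim_snoc_vec_le_Suc:
  fixes S :: "(real ^ 'd) set"
  assumes "\<And>v. v \<in> R \<Longrightarrow> \<exists>x\<in>S. \<exists>t. v = snoc_vec x t"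
  shows "dim R \<le> Suc (dim S)"
proof -
  let ?E = "insert (axis None 1) ((\<lambda>x. snoc_vec x 0) ` S)"
  have "R \<subseteq> span ?E"
  proof
    fix v assume "v \<in> R"
    then obtain x t where "x \<in> S" "v = snoc_vec x 0 + t *\<^sub>R axis None 1"
      using assms snoc_vec_eq by metis
    then show "v \<in> span ?E" by (auto intro!: span_add span_mul intro: span_base)
  qed
  then have "dim R \<le> dim ?E" by (metis dim_span dim_subset)
  also have "\<dots> \<le> Suc (dim ((\<lambda>x. snoc_vec x 0) ` S))" by (simp add: dim_insert)
  also have "\<dots> \<le> Suc (dim S)" using dim_image_le[OF linear_snoc_vec_0, of S] by simp
  finally show ?thesis .
qed

section \<open>The stopping rule and the output of the procedure\<close>

text \<open>The witness has the dimension prescribed by \<^const>\<open>dr_step\<close>, so the stopping rule applies.\<close>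

lemma stopped_cost_bound:
  fixes A :: "real ^ 'd ^ 'n"
  assumes S: "subspace S" and stop: "\<nexists>S'. dr_step A k \<epsilon> p S S'"
    and V: "subspace V" "dim V = k" and "k \<ge> 1"
  obtains T where "subspace T" "S \<subseteq> T" "V \<subseteq> T"
    "cost p A S - cost p A T \<le> \<epsilon> powr max (2 / p) 1 * opt p A k / 80"
proof (cases "S = UNIV")
  case True
  then show ?thesis using that[of UNIV] opt_nonneg[OF V, of p A] by simp
next
  case False
  define U where "U = {x + y |x y. x \<in> S \<and> y \<in> V}"
  have "x \<in> U" if "x \<in> S" for x
    unfolding U_def using that subspace_0[OF V(1)]
    by (intro CollectI) (rule exI[of _ x], rule exI[of _ 0], simp)
  moreover have "x \<in> U" if "x \<in> V" for x
    unfolding U_def using that subspace_0[OF S]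
    by (intro CollectI) (rule exI[of _ 0], rule exI[of _ x], simp)
  ultimately have U: "subspace U" "S \<subseteq> U" "V \<subseteq> U"
    unfolding U_def using subspace_sums[OF S V(1)] by auto
  have "dim U \<le> dim S + k" "dim U \<le> CARD('d)"
    using dim_sums_Int[OF S V(1)] dim_subset_UNIV[of U] V by (auto simp: U_def)
  then obtain T where T: "subspace T" "U \<subseteq> T" "dim T = min (dim S + k) CARD('d)"
    using subspace_of_dim_between[OF U(1), of "min (dim S + k) CARD('d)"] by auto
  have "dim S \<noteq> CARD('d)"
    using False dim_eq_full[of S] S by (auto simp: span_eq_iff[THEN iffD2])
  then have "dim S < dim T"
    using dim_subset_UNIV[of S] \<open>k \<ge> 1\<close> T(3) by auto
  \<comment> \<open>With strict inclusion and the right dimension secured, the cost condition is the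
    only part of \<open>dr_step\<close> that can fail.\<close>
  then have "S \<subset> T" using T(2) U(2) by auto
  then have "\<not> cost p A T \<le> cost p A S - \<epsilon> powr max (2 / p) 1 * opt p A k / 80"
    using stop T by (auto simp: dr_step_def)
  then show ?thesis using that[OF T(1)] T(2) U by auto
qed

lemma dimensionality_reductionE:
  fixes A :: "real ^ 'd ^ 'n"
  assumes "dimensionality_reduction A k \<epsilon> p B"
  obtains S\<^sub>0 S Y m where "subspace S\<^sub>0" "dim S\<^sub>0 = k" "cost p A S\<^sub>0 \<le> (1 + \<epsilon>) * opt p A k"
    "subspace S" "S\<^sub>0 \<subseteq> S" "dim S \<le> k + m * k"
    "cost p A S + real m * (\<epsilon> powr max (2 / p) 1 * opt p A k / 80) \<le> cost p A S\<^sub>0"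
    "\<nexists>S'. dr_step A k \<epsilon> p S S'" "\<And>i. is_orthogonal_projection S (A $ i) (Y i)"
    "B = (\<chi> i. snoc_vec (Y i) (norm (A $ i - Y i)))"
proof -
  obtain S\<^sub>0 S and A' :: "real ^ 'd ^ 'n" where
    S0: "subspace S\<^sub>0" "dim S\<^sub>0 = k" "cost p A S\<^sub>0 \<le> (1 + \<epsilon>) * opt p A k"
    and steps: "(dr_step A k \<epsilon> p)\<^sup>*\<^sup>* S\<^sub>0 S"
    and S: "\<nexists>S'. dr_step A k \<epsilon> p S S'" "\<And>i. is_orthogonal_projection S (A $ i) (A' $ i)"
    and B: "B = (\<chi> i j. case j of Some l \<Rightarrow> A' $ i $ l | None \<Rightarrow> norm (A $ i - A' $ i))"
    using assms unfolding dimensionality_reduction_def by blast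
  from dr_steps_invariant[OF steps S0(1)] that[OF S0 _ _ _ _ S] S0(2) B show thesis
    unfolding snoc_vec_def by metis
qed

section \<open>The rank bound\<close>

lemma rank_dimensionality_reduction:
  fixes A :: "real ^ 'd ^ 'n"
  assumes "0 < \<epsilon>" "\<epsilon> \<le> 1" "k \<ge> 1" "dimensionality_reduction A k (\<epsilon> / 2) 1 B"
  shows "real (rank B) \<le> 500 * real k / \<epsilon>\<^sup>2"
  using assms(4)
proof (cases rule: dimensionality_reductionE)
  case (1 S\<^sub>0 S Y m)
  have \<epsilon>2: "0 < \<epsilon>\<^sup>2" "\<epsilon>\<^sup>2 \<le> 1" using assms by (simp_all add: power_le_one)
  let ?o = "opt 1 A k"
  have rows: "v \<in> rows B \<Longrightarrow> \<exists>i. v = snoc_vec (Y i) (norm (A $ i - Y i))" for v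
    using 1(10) by (auto simp: rows_def row_def)
  have Y: "Y i \<in> S" "infdist (A $ i) S = norm (A $ i - Y i)" for i
    using 1(9)[of i] infdist_eq_norm_orthogonal_projection[OF 1(4)]
    by (auto simp: is_orthogonal_projection_def)
  have bound: "cost 1 A S + real m * ((\<epsilon> / 2)\<^sup>2 * ?o / 80) \<le> (1 + \<epsilon> / 2) * ?o"
    using 1(3,7) \<open>0 < \<epsilon>\<close> by (simp add: powr_realpow[of "\<epsilon> / 2" 2, simplified])
  show ?thesis
  proof (cases "?o = 0")
    case True
    then have "cost 1 A S\<^sub>0 = 0" using 1(3) cost_nonneg[of 1 A S\<^sub>0] by simp
    then have "infdist (A $ i) S\<^sub>0 = 0" for i
      by (simp add: cost_1 sum_nonneg_eq_0_iff infdist_nonneg)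
    then have A: "A $ i \<in> S\<^sub>0" for i
      using in_closed_iff_infdist_zero[OF closed_subspace[OF 1(1)]] subspace_0[OF 1(1)] by blast
    \<comment> \<open>Rows in the initial subspace lie in \<open>S\<close> as well, so projecting
      fixes them and the last column is 0.\<close>
    then have "Y i = A $ i" for i using 1(5) Y(2)[of i] by (force simp: subset_iff)
    then have "rows B \<subseteq> (\<lambda>x. snoc_vec x 0) ` S\<^sub>0"
      using rows A by fastforce
    then have "rank B \<le> k"
      using dim_snoc_vec_le 1(2) unfolding row_rank_def by blast
    moreover have "real k * \<epsilon>\<^sup>2 \<le> 500 * real k"
      using mult_left_mono[OF \<epsilon>2(2), of "real k"] by simp
    then have "real k \<le> 500 * real k / \<epsilon>\<^sup>2" using \<epsilon>2 by (simp add: field_simps)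
    ultimately show ?thesis by linarith
  next
    case False
    then have o: "0 < ?o" using opt_nonneg[OF 1(1,2), of 1 A] by simp
    have "?o * (real m * \<epsilon>\<^sup>2) \<le> ?o * 480"
    proof -
      have "?o * \<epsilon> \<le> ?o" using o assms by simp
      then show ?thesis
        using bound cost_nonneg[of 1 A S] by (simp add: field_simps power_divide)
    qed
    then have m: "real m * \<epsilon>\<^sup>2 \<le> 480" using o by simp
    have "rank B \<le> Suc (dim S)"
      unfolding row_rank_def by (rule dim_snoc_vec_le_Suc) (use rows Y(1) in blast)
    \<comment> \<open>The dimension added by the last column is absorbed into a second
      \<open>k\<close>.\<close>
    then have "rank B \<le> 2 * k + m * k" using 1(6) \<open>k \<ge> 1\<close> by linarith
    then have "real (rank B) \<le> real k * (2 + real m)"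
      by (metis distrib_right mult.commute of_nat_add of_nat_le_iff of_nat_mult of_nat_numeral)
    then have "real (rank B) * \<epsilon>\<^sup>2 \<le> real k * (2 + real m) * \<epsilon>\<^sup>2"
      using \<epsilon>2 by (intro mult_right_mono) auto
    also have "\<dots> = real k * (2 * \<epsilon>\<^sup>2 + real m * \<epsilon>\<^sup>2)" by (simp add: algebra_simps)
    \<comment> \<open>The sum is at most 2 + 480; 500 is a rounded constant.\<close>
    also have "\<dots> \<le> real k * 500" using m \<epsilon>2 by (intro mult_left_mono) auto
    finally show ?thesis using \<epsilon>2 by (simp add: field_simps)
  qed
qed

section \<open>The approximation bound\<close>

lemma norm_dimensionality_reduction:
  fixes A A' B' :: "real ^ 'd ^ 'n"
  assumes \<epsilon>: "0 < \<epsilon>" "\<epsilon> \<le> 1" and "k \<ge> 1"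
    and red: "dimensionality_reduction A k (\<epsilon> / 2) 1 B"
    and V: "subspace V" "dim V = k" "C \<subseteq> V"
    and A': "\<And>i. is_closest_point (closure C) (A $ i) (A' $ i)"
    and B': "\<And>i. is_closest_point (closure C) ((B ** drop_last) $ i) (B' $ i)"
  shows "\<bar>norm_p2 1 (A - A') - norm_p2 1 (B - B' ** transpose drop_last)\<bar> \<le> \<epsilon> * norm_p2 1 (A - A')"
  using red
proof (cases rule: dimensionality_reductionE)
  case (1 S\<^sub>0 S Y m)
  note S = 1(4) and Y = 1(9) and B = 1(10)
  obtain T where T: "subspace T" "S \<subseteq> T" "V \<subseteq> T"
    "cost 1 A S - cost 1 A T \<le> (\<epsilon> / 2) powr max (2 / 1) 1 * opt 1 A k / 80"
    using stopped_cost_bound[OF S 1(8) V(1,2) \<open>k \<ge> 1\<close>] by metis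
  define Z where "Z i = (SOME z. is_orthogonal_projection T (A $ i) z)" for i
  have Z: "is_orthogonal_projection T (A $ i) (Z i)" for i
    unfolding Z_def by (rule someI_ex) (rule orthogonal_projection_exists[OF T(1)])
  define r where "r i = norm (A $ i - Y i)" for i
  define q where "q i = norm (A $ i - Z i)" for i
  let ?o = "opt 1 A k"
  have o: "0 \<le> ?o" by (rule opt_nonneg[OF V(1,2)])
  have sr: "sum r UNIV = cost 1 A S"
    by (simp add: cost_1 r_def infdist_eq_norm_orthogonal_projection[OF S Y])
  have sq: "sum q UNIV = cost 1 A T"
    by (simp add: cost_1 q_def infdist_eq_norm_orthogonal_projection[OF T(1) Z])
  have qr: "q i \<le> r i" for i
    using infdist_mono[OF T(2), of "A $ i"] subspace_0[OF S]
    by (auto simp: q_def r_def infdist_eq_norm_orthogonal_projection[OF T(1) Z]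
        infdist_eq_norm_orthogonal_projection[OF S Y])
  \<comment> \<open>Closest points are taken in the closure, which must still lie in
    \<open>T\<close> for the distortion bound to apply.\<close>
  have C: "closure C \<subseteq> V" using closure_minimal[OF V(3) closed_subspace[OF V(1)]] .
  have rowB: "(B - B' ** transpose drop_last) $ i = snoc_vec (Y i - B' $ i) (r i)" for i
    by (simp add: B matrix_mult_transpose_drop_last snoc_vec_diff r_def)
  have row: "\<bar>norm ((A - A') $ i) - norm ((B - B' ** transpose drop_last) $ i)\<bar>
      \<le> sqrt (2 * r i * (r i - q i))" for i
  proof -
    have mA: "A' $ i \<in> closure C"
        "\<And>c. c \<in> closure C \<Longrightarrow> norm (A $ i - A' $ i) \<le> norm (A $ i - c)"
      using A'[of i] by (auto simp: is_closest_point_def dist_norm)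
    have mB: "B' $ i \<in> closure C"
        "\<And>c. c \<in> closure C \<Longrightarrow> norm (Y i - B' $ i) \<le> norm (Y i - c)"
      using B'[of i] unfolding B matrix_mult_drop_last by (auto simp: is_closest_point_def dist_norm)
    have "\<bar>norm (A $ i - A' $ i) - norm (Y i - B' $ i, r i)\<bar> \<le> sqrt (2 * r i * (r i - q i))"
    proof (rule abs_diff_le_of_minimizers[where C = "closure C" and f = "\<lambda>c. norm (A $ i - c)"
          and g = "\<lambda>c. norm (Y i - c, r i)"])
      fix c assume c: "c \<in> closure C"
      then have "c \<in> T" using C T(3) by blast
      then show "\<bar>norm (A $ i - c) - norm (Y i - c, r i)\<bar> \<le> sqrt (2 * r i * (r i - q i))"
        unfolding r_def q_def using distance_distortion[OF S Y T(1) Z T(2)] by blast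
      \<comment> \<open>The appended coordinate \<open>r i\<close> does not depend on
        \<open>c\<close>, so minimizing with or without it is the same.\<close>
      show "norm (Y i - B' $ i, r i) \<le> norm (Y i - c, r i)"
        using mB(2)[OF c] by (simp add: norm_Pair power_mono)
    qed (use mA mB in auto)
    then show ?thesis by (simp add: rowB norm_snoc_vec del: vector_minus_component
          add: vector_minus_component[of A A'])
  qed
  have "sum r UNIV \<le> (1 + \<epsilon> / 2) * ?o"
    using cost_1_antimono[OF _ 1(5), of A] subspace_0[OF 1(1)] 1(3) unfolding sr by force
  also have "\<dots> \<le> 2 * ?o" using \<epsilon> o by (intro mult_right_mono) auto
  finally have r_le: "sum r UNIV \<le> 2 * ?o" .
  \<comment> \<open>At \<open>p = 1\<close> the exponent is 2, and running with
    \<open>\<epsilon> / 2\<close> turns 80 into 320.\<close>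
  have d_le: "(\<Sum>i\<in>UNIV. r i - q i) \<le> \<epsilon>\<^sup>2 * ?o / 320"
    using T(4) \<epsilon>(1)
    by (simp add: sum_subtractf sr sq powr_realpow[of "\<epsilon> / 2" 2, simplified] power_divide)
  have "\<bar>norm_p2 1 (A - A') - norm_p2 1 (B - B' ** transpose drop_last)\<bar>
      \<le> (\<Sum>i\<in>UNIV. \<bar>norm ((A - A') $ i) - norm ((B - B' ** transpose drop_last) $ i)\<bar>)"
    unfolding norm_p2_1 sum_subtractf[symmetric] by (rule sum_abs)
  also have "\<dots> \<le> (\<Sum>i\<in>UNIV. sqrt (2 * r i * (r i - q i)))"
    by (intro sum_mono row)
  also have "\<dots> \<le> sqrt ((\<Sum>i\<in>UNIV. 2 * r i) * (\<Sum>i\<in>UNIV. r i - q i))"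
    using qr by (intro sum_sqrt_mult_le) (auto simp: r_def)
  also have "\<dots> \<le> sqrt ((4 * ?o) * (\<epsilon>\<^sup>2 * ?o / 320))"
    using r_le d_le o qr
    by (intro real_sqrt_le_mono mult_mono) (auto simp: sum_distrib_left[symmetric] intro: sum_nonneg)
  \<comment> \<open>The radicand is \<open>\<epsilon>\<^sup>2 * ?o\<^sup>2 / 80\<close>, so a factor
    \<open>sqrt 80\<close> is to spare.\<close>
  also have "\<dots> \<le> \<epsilon> * ?o"
    by (rule real_le_lsqrt) (use \<epsilon> o in \<open>auto simp: power2_eq_square\<close>)
  \<comment> \<open>The rows of \<open>A'\<close> lie in \<open>V\<close>, a competitor in the
    definition of \<open>opt\<close>; this makes the error relative.\<close>
  also have "?o \<le> norm_p2 1 (A - A')"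
  proof -
    have "A' $ i \<in> V" for i using A'[of i] C by (auto simp: is_closest_point_def)
    then have "cost 1 A V \<le> norm_p2 1 (A - A')"
      unfolding cost_1 norm_p2_1 by (intro sum_mono) (auto simp: dist_norm[symmetric] intro: infdist_le)
    with opt_le_cost[OF V(1,2), of 1 A] show ?thesis by linarith
  qed
  finally show ?thesis using \<epsilon>(1) by simp
qed

theorem theorem1:
  fixes A A' B' :: "real ^ 'd ^ 'n"
    and B :: "real ^ 'd option ^ 'n"
    and C :: "(real ^ 'd) set"
    and k :: nat
    and \<epsilon> :: real
  assumes "0 < \<epsilon>" and "\<epsilon> \<le> 1"
    and "k \<ge> 1"
    and "dimensionality_reduction A k (\<epsilon> / 2) 1 B"
    and "C \<noteq> {}"
    and "\<exists>V. subspace V \<and> dim V = k \<and> C \<subseteq> V"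
    and "\<And>i. is_closest_point (closure C) (A $ i) (A' $ i)"
    and "\<And>i. is_closest_point (closure C) ((B ** drop_last) $ i) (B' $ i)"
  shows "real (rank B) \<le> 500 * real k / \<epsilon>\<^sup>2 \<and>
    \<bar>norm_p2 1 (A - A') - norm_p2 1 (B - B' ** transpose drop_last)\<bar> \<le> \<epsilon> * norm_p2 1 (A - A')"
proof -
  obtain V where V: "subspace V" "dim V = k" "C \<subseteq> V" using assms(6) by blast
  show ?thesis
    using rank_dimensionality_reduction[OF assms(1-4)]
      norm_dimensionality_reduction[OF assms(1-4) V assms(7,8)] by blast
qed

end
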